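(* For $n\ge1$ let $p_n(t)=t(t-1)(t-2)\cdots(t-n)$. The derivative $p_n'$ has exactly one root strictly between each two consecutive roots of $p_n$, so write $p_n'(t)=(n+1)\prod_{k=0}^{n-1}\bigl(t-(k+\lambda_{n,k})\bigr)$ with $0<\lambda_{n,k}<1$. Then for all $0<x<1$, $$\lim_{n\to\infty}\lambda_{n,\lfloor xn\rfloor}=\frac1\pi\operatorname{arccot}\left[\frac1\pi\log\left(\frac{1-x}{x}\right)\right].$$
   Context: $\operatorname{arccot}$ denotes the branch of the inverse cotangent with values in $(0,\pi)$. *)

theory Defs
  imports Complex_Main "HOL-Computational_Algebra.Polynomial"
begin

definition p :: "nat \<Rightarrow> real poly" where
  "p n = (\<Prod>k=0..n. [:- real k, 1:])"

definition arccot :: "real \<Rightarrow> real" where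
  "arccot y = (THE \<theta>. 0 < \<theta> \<and> \<theta> < pi \<and> cot \<theta> = y)"

text \<open>
  For \<open>k < n\<close>, the unique root of the derivative of \<open>p n\<close> in the open interval from \<open>k\<close> to
  \<open>k + 1\<close> is \<open>k + lam n k\<close>.  For \<open>k \<ge> n\<close> the value is irrelevant.
\<close>
definition lam :: "nat \<Rightarrow> nat \<Rightarrow> real" where
  "lam n k = (THE l. 0 < l \<and> l < 1 \<and> poly (pderiv (p n)) (real k + l) = 0)"

end

theory Submission
  imports Defs "HOL-Analysis.Gamma_Function"
begin

text \<open>
  Between \<open>k\<close> and \<open>k + 1\<close> the roots of \<open>p\<^sub>n'\<close> are those of the logarithmic derivative
  \<open>\<Sum>i\<le>n. 1 / (t - i)\<close>, which is strictly decreasing there. At \<open>t = k + l\<close> it is a difference of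
  two harmonic-like sums, asymptotic to \<open>ln k - \<psi>(l)\<close> and \<open>ln (n - k) - \<psi>(1 - l)\<close>; for
  \<open>k = \<lfloor>x n\<rfloor>\<close> and fixed \<open>l\<close> the reflection formula for the digamma function \<open>\<psi>\<close> gives the limit
  \<open>\<pi> cot (\<pi> l) - ln ((1 - x) / x)\<close>. By monotonicity the sign of this limit decides on which side of
  \<open>l\<close> the root eventually lies, so pointwise convergence suffices.
\<close>

section \<open>The branch of the inverse cotangent\<close>

lemma cot_eq_iff_arctan:
  fixes \<theta> y :: real
  assumes "0 < \<theta>" "\<theta> < pi"
  shows "cot \<theta> = y \<longleftrightarrow> \<theta> = pi / 2 - arctan y"
proof -
  have "cot \<theta> = tan (pi / 2 - \<theta>)"
    by (simp add: tan_cot')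
  moreover have "arctan (tan (pi / 2 - \<theta>)) = pi / 2 - \<theta>"
    using assms by (intro arctan_tan) auto
  ultimately show ?thesis
    by (metis add_diff_cancel_left' diff_add_cancel tan_arctan)
qed

lemma arccot_eq: "arccot y = pi / 2 - arctan y"
  unfolding arccot_def
proof (rule the_equality)
  show "0 < pi / 2 - arctan y \<and> pi / 2 - arctan y < pi \<and> cot (pi / 2 - arctan y) = y"
    using arctan_bounded[of y] cot_eq_iff_arctan[of "pi / 2 - arctan y" y] by auto
qed (use cot_eq_iff_arctan in blast)

text \<open>On (0, \<pi>) every \<theta> equals \<open>pi / 2 - arctan (cot \<theta>)\<close>, so
  monotonicity of \<open>arctan\<close> reverses the order.\<close>

lemma arccot_less_iff:
  assumes "0 < \<theta>" "\<theta> < pi"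
  shows "\<theta> < arccot y \<longleftrightarrow> y < cot \<theta>" "arccot y < \<theta> \<longleftrightarrow> cot \<theta> < y"
  using cot_eq_iff_arctan[OF assms, of "cot \<theta>"]
    arctan_less_iff[of y "cot \<theta>"] arctan_less_iff[of "cot \<theta>" y]
  unfolding arccot_eq by auto

lemma arccot_bounds: "0 < arccot y" "arccot y < pi"
  using arctan_bounded[of y] by (auto simp: arccot_eq)

section \<open>Reflection formula for the digamma function\<close>

text \<open>Transferred from the complex formula through injectivity of \<open>of_real\<close>; with
  the reciprocal Gamma function no poles have to be excluded.\<close>

lemma rGamma_reflection_real:
  fixes x :: real
  shows "rGamma x * rGamma (1 - x) = sin (pi * x) / pi"
proof -
  have "complex_of_real (rGamma x * rGamma (1 - x)) =
      rGamma (of_real x) * rGamma (1 - of_real x)"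
    by (simp only: of_real_mult rGamma_complex_of_real[symmetric] of_real_diff of_real_1)
  also have "\<dots> = complex_of_real (sin (pi * x) / pi)"
    unfolding rGamma_reflection_complex
    by (simp only: of_real_divide sin_of_real[symmetric] of_real_mult)
  finally have "complex_of_real (rGamma x * rGamma (1 - x)) = of_real (sin (pi * x) / pi)" .
  then show ?thesis
    unfolding of_real_eq_iff .
qed

text \<open>Differentiate both sides of the reflection formula for \<open>rGamma\<close>, using
  \<open>rGamma' = - rGamma * Digamma\<close>, and divide by \<open>sin (pi * x) / pi\<close>, which
  is positive on (0, 1).\<close>

lemma Digamma_reflection_real:
  fixes x :: real
  assumes "0 < x" "x < 1"
  shows "Digamma (1 - x) - Digamma x = pi * cot (pi * x)"
proof -
  have nz: "x \<notin> \<int>\<^sub>\<le>\<^sub>0" "1 - x \<notin> \<int>\<^sub>\<le>\<^sub>0"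
    using assms by (auto elim!: nonpos_Ints_cases)
  have "((\<lambda>x. rGamma x * rGamma (1 - x)) has_field_derivative
      rGamma x * rGamma (1 - x) * (Digamma (1 - x) - Digamma x)) (at x)"
    using nz by (auto intro!: derivative_eq_intros simp: algebra_simps)
  moreover have "((\<lambda>x. sin (pi * x) / pi) has_field_derivative cos (pi * x)) (at x)"
    by (auto intro!: derivative_eq_intros)
  ultimately have "sin (pi * x) / pi * (Digamma (1 - x) - Digamma x) = cos (pi * x)"
    unfolding rGamma_reflection_real by (rule DERIV_unique)
  moreover have "sin (pi * x) > 0"
    using assms by (intro sin_gt_zero) auto
  ultimately show ?thesis
    by (simp add: cot_def field_simps)
qed

section \<open>The critical points\<close>

definition logderiv_p :: "nat \<Rightarrow> real \<Rightarrow> real" where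
  "logderiv_p n t = (\<Sum>i=0..n. 1 / (t - real i))"

lemma poly_p: "poly (p n) t = (\<Prod>i=0..n. t - real i)"
  by (simp add: p_def poly_prod)

text \<open>In the product rule each summand omits one factor, which away from the roots can be
  restored by division.\<close>

lemma poly_pderiv_p:
  assumes "\<And>i. i \<le> n \<Longrightarrow> t \<noteq> real i"
  shows "poly (pderiv (p n)) t = poly (p n) t * logderiv_p n t"
proof -
  have "poly (pderiv (p n)) t = (\<Sum>i=0..n. \<Prod>j\<in>{0..n} - {i}. t - real j)"
    by (simp add: p_def pderiv_prod poly_sum poly_prod pderiv_pCons)
  also have "\<dots> = (\<Sum>i=0..n. poly (p n) t * (1 / (t - real i)))"
    using assms by (intro sum.cong) (auto simp: poly_p prod_diff1)
  finally show ?thesis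
    by (simp add: logderiv_p_def sum_distrib_left)
qed

lemma not_of_nat_between:
  assumes "real k < t" "t < real k + 1"
  shows "t \<noteq> real i"
  using assms by auto

lemma poly_pderiv_p_eq_0_iff:
  assumes "real k < t" "t < real k + 1"
  shows "poly (pderiv (p n)) t = 0 \<longleftrightarrow> logderiv_p n t = 0"
  using not_of_nat_between[OF assms]
  by (simp add: poly_pderiv_p) (simp add: poly_p)

text \<open>No pole lies strictly between \<open>k\<close> and \<open>k + 1\<close>, so
  \<open>s - i\<close> and \<open>t - i\<close> have the same sign and every summand
  decreases.\<close>

lemma logderiv_p_strict_antimono:
  assumes "real k < s" "s < t" "t < real k + 1"
  shows "logderiv_p n t < logderiv_p n s"
  unfolding logderiv_p_def
proof (rule sum_strict_mono)
  fix i assume "i \<in> {0..n}"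
  show "1 / (t - real i) < 1 / (s - real i)"
  proof (cases "i \<le> k")
    case True
    then have "0 < s - real i" using assms by auto
    then show ?thesis using assms by (intro divide_strict_left_mono) auto
  next
    case False
    then have "t - real i < 0" using assms by auto
    then show ?thesis using assms by (simp add: divide_simps)
  qed
qed auto

text \<open>Existence is Rolle's theorem; uniqueness holds because a strictly decreasing logarithmic
  derivative vanishes at most once.\<close>

lemma ex1_root_pderiv_p:
  assumes "k < n"
  shows "\<exists>!t. real k < t \<and> t < real k + 1 \<and> poly (pderiv (p n)) t = 0"
proof (rule ex_ex1I)
  have "poly (p n) (real k) = 0" "poly (p n) (real k + 1) = 0"
    using assms by (auto simp: poly_p intro!: bexI[of _ k] bexI[of _ "Suc k"])
  then have "\<exists>z>real k. z < real k + 1 \<and> DERIV (poly (p n)) z :> 0"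
    by (intro Rolle) (auto intro!: continuous_intros
        simp: real_differentiable_def intro: poly_DERIV)
  then show "\<exists>t. real k < t \<and> t < real k + 1 \<and> poly (pderiv (p n)) t = 0"
    using DERIV_unique poly_DERIV by blast
next
  fix s t
  assume *: "real k < s \<and> s < real k + 1 \<and> poly (pderiv (p n)) s = 0"
    "real k < t \<and> t < real k + 1 \<and> poly (pderiv (p n)) t = 0"
  then have "logderiv_p n s = 0" "logderiv_p n t = 0"
    using poly_pderiv_p_eq_0_iff by blast+
  then show "s = t"
    using * logderiv_p_strict_antimono[of k s t n] logderiv_p_strict_antimono[of k t s n]
    by (cases s t rule: linorder_cases) auto
qed

lemma lam_root:
  assumes "k < n"
  shows "0 < lam n k" "lam n k < 1" "poly (pderiv (p n)) (real k + lam n k) = 0"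
proof -
  obtain t where t: "real k < t \<and> t < real k + 1 \<and> poly (pderiv (p n)) t = 0"
    and uniq: "\<And>s. real k < s \<and> s < real k + 1 \<and> poly (pderiv (p n)) s = 0 \<Longrightarrow> s = t"
    using ex1_root_pderiv_p[OF assms] by blast
  have "0 < lam n k \<and> lam n k < 1 \<and> poly (pderiv (p n)) (real k + lam n k) = 0"
    unfolding lam_def
  proof (rule theI)
    show "0 < t - real k \<and> t - real k < 1 \<and> poly (pderiv (p n)) (real k + (t - real k)) = 0"
      using t by auto
    show "l = t - real k"
      if "0 < l \<and> l < 1 \<and> poly (pderiv (p n)) (real k + l) = 0" for l
      using that uniq[of "real k + l"] by auto
  qed
  then show "0 < lam n k" "lam n k < 1" "poly (pderiv (p n)) (real k + lam n k) = 0"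
    by auto
qed

lemma logderiv_p_lam: "k < n \<Longrightarrow> logderiv_p n (real k + lam n k) = 0"
  using lam_root poly_pderiv_p_eq_0_iff[of k "real k + lam n k" n] by auto

text \<open>The logarithmic derivative decreases through 0 at \<open>k + lam n k\<close>, so its
  sign at \<open>k + l\<close> locates \<open>l\<close> relative to the root.\<close>

lemma less_lam_if_logderiv_p_pos:
  assumes "k < n" "0 < l" "l < 1" "0 < logderiv_p n (real k + l)"
  shows "l < lam n k"
  using assms logderiv_p_lam[of k n] lam_root[of k n]
    logderiv_p_strict_antimono[of k "real k + lam n k" "real k + l" n]
  by (cases l "lam n k" rule: linorder_cases) auto

lemma lam_less_if_logderiv_p_neg:
  assumes "k < n" "0 < l" "l < 1" "logderiv_p n (real k + l) < 0"
  shows "lam n k < l"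
  using assms logderiv_p_lam[of k n] lam_root[of k n]
    logderiv_p_strict_antimono[of k "real k + l" "real k + lam n k" n]
  by (cases l "lam n k" rule: linorder_cases) auto

lemma degree_p: "degree (p n) = Suc n"
  by (simp add: p_def degree_prod_sum_eq)

text \<open>Two polynomials of degree at most \<open>n\<close> coincide if they agree at
  \<open>n\<close> points, here the roots, and in the coefficient of degree
  \<open>n\<close>.\<close>

lemma pderiv_p_factorization:
  "pderiv (p n) = smult (real n + 1) (\<Prod>k=0..<n. [:- (real k + lam n k), 1:])"
    (is "_ = ?q")
proof (rule poly_eqI_degree_lead_coeff[where n = n])
  let ?A = "(\<lambda>k. real k + lam n k) ` {0..<n}"
  \<comment> \<open>The roots are distinct since they lie in disjoint unit intervals.\<close>
  have "inj_on (\<lambda>k. real k + lam n k) {0..<n}"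
  proof (rule inj_onI)
    fix i j assume *: "i \<in> {0..<n}" "j \<in> {0..<n}" "real i + lam n i = real j + lam n j"
    then show "i = j"
      using lam_root(1,2)[of i n] lam_root(1,2)[of j n] by auto
  qed
  then show "n \<le> card ?A"
    by (simp add: card_image)
  show "poly (pderiv (p n)) z = poly ?q z" if "z \<in> ?A" for z
    using that lam_root(3) by (force simp: poly_prod)
  show "degree (pderiv (p n)) \<le> n"
    by (simp add: degree_pderiv degree_p)
  have deg: "degree (\<Prod>k=0..<n. [:- (real k + lam n k), 1:]) = n"
    by (subst degree_prod_sum_eq) auto
  then show "degree ?q \<le> n"
    by simp
  have "coeff (pderiv (p n)) n = real (Suc n) * lead_coeff (p n)"
    by (simp add: coeff_pderiv degree_p)
  also have "lead_coeff (p n) = 1"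
    by (simp add: p_def lead_coeff_prod)
  finally show "coeff (pderiv (p n)) n = coeff ?q n"
    using lead_coeff_prod[of "\<lambda>k. [:- (real k + lam n k), 1:]" "{0..<n}"] deg by simp
qed

section \<open>The limit\<close>

text \<open>Poles at or left of \<open>k\<close> are indexed by \<open>i = k - j\<close>, those to
  the right by \<open>i = k + 1 + j\<close>; this gives the partial sums that occur in the limit
  formula for \<open>Digamma\<close>.\<close>

lemma logderiv_p_split:
  assumes "k < n"
  shows "logderiv_p n (real k + l) =
    (\<Sum>j<Suc k. inverse (l + real j)) - (\<Sum>j<n - k. inverse (1 - l + real j))"
proof -
  have "logderiv_p n (real k + l) =
      (\<Sum>i<Suc k. 1 / (real k + l - real i)) + (\<Sum>i\<in>{Suc k..<Suc n}. 1 / (real k + l - real i))"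
    unfolding logderiv_p_def using assms
    by (subst sum.union_disjoint[symmetric]) (auto intro!: sum.cong)
  also have "(\<Sum>i<Suc k. 1 / (real k + l - real i)) = (\<Sum>j<Suc k. inverse (l + real j))"
    by (rule sum.reindex_bij_witness[of _ "\<lambda>j. k - j" "\<lambda>j. k - j"])
      (auto simp: inverse_eq_divide of_nat_diff algebra_simps)
  also have "(\<Sum>i\<in>{Suc k..<Suc n}. 1 / (real k + l - real i)) =
      (\<Sum>j<n - k. - inverse (1 - l + real j))"
    by (rule sum.reindex_bij_witness[of _ "\<lambda>j. j + Suc k" "\<lambda>i. i - Suc k"])
      (use assms in \<open>auto simp: of_nat_diff inverse_eq_divide
        simp flip: minus_divide_right divide_minus_right intro!: arg_cong2[of _ _ _ _ "(/)"]\<close>)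
  finally show ?thesis
    by (simp add: sum_negf)
qed

lemma at_top_if_ratio_tendsto_pos:
  fixes f :: "nat \<Rightarrow> nat" and c :: real
  assumes "(\<lambda>n. real (f n) / real n) \<longlonglongrightarrow> c" "0 < c"
  shows "filterlim f at_top sequentially"
proof -
  have "filterlim (\<lambda>n. real (f n) / real n * real n) at_top sequentially"
    using assms filterlim_real_sequentially by (rule filterlim_tendsto_pos_mult_at_top)
  then have *: "\<forall>\<^sub>F n in sequentially. real Z \<le> real (f n) / real n * real n" for Z
    by (simp add: filterlim_at_top)
  have "\<forall>\<^sub>F n in sequentially. Z \<le> f n" for Z
    using *[of Z] eventually_gt_at_top[of 0] by eventually_elim auto
  then show ?thesis
    by (simp add: filterlim_at_top)
qed

lemma logderiv_p_tendsto:
  fixes x l :: real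
  assumes x: "0 < x" "x < 1" and l: "0 < l" "l < 1"
  shows "(\<lambda>n. logderiv_p n (real (nat \<lfloor>x * real n\<rfloor>) + l))
    \<longlonglongrightarrow> pi * cot (pi * l) - ln ((1 - x) / x)"
proof -
  define k where "k n = nat \<lfloor>x * real n\<rfloor>" for n
  have k_bounds: "real (k n) \<le> x * real n" "x * real n < real (k n) + 1" for n
    using x by (auto simp: k_def)
  have k_less: "k n < n" if "n > 0" for n
  proof -
    have "x * real n < real n" using x that by simp
    with k_bounds(1)[of n] show ?thesis by linarith
  qed
  \<comment> \<open>\<open>Suc (k n)\<close> and \<open>n - k n\<close> are the lengths of the two
    sums in \<open>logderiv_p_split\<close>.\<close>
  have lim1: "(\<lambda>n. real (Suc (k n)) / real n) \<longlonglongrightarrow> x"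
  proof (rule tendsto_sandwich)
    have "\<forall>\<^sub>F n in sequentially. x = x * real n / real n"
      using eventually_gt_at_top[of 0] by eventually_elim simp
    then show "(\<lambda>n. x * real n / real n) \<longlonglongrightarrow> x"
      by (rule Lim_transform_eventually[OF tendsto_const])
    have "\<forall>\<^sub>F n in sequentially. x + 1 / real n = (x * real n + 1) / real n"
      using eventually_gt_at_top[of 0] by eventually_elim (simp add: field_simps)
    moreover have "(\<lambda>n. x + 1 / real n) \<longlonglongrightarrow> x + 0"
      by (intro tendsto_add tendsto_const lim_1_over_n)
    ultimately show "(\<lambda>n. (x * real n + 1) / real n) \<longlonglongrightarrow> x"
      using Lim_transform_eventually by fastforce
    show "\<forall>\<^sub>F n in sequentially. x * real n / real n \<le> real (Suc (k n)) / real n"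
      "\<forall>\<^sub>F n in sequentially. real (Suc (k n)) / real n \<le> (x * real n + 1) / real n"
      using k_bounds
      by (intro always_eventually allI divide_right_mono; simp add: add.commute less_imp_le)+
  qed
  have lim2: "(\<lambda>n. real (n - k n) / real n) \<longlonglongrightarrow> 1 - x"
  proof -
    \<comment> \<open>Uses \<open>n - k n = n + 1 - Suc (k n)\<close>, divided by
      \<open>n\<close>.\<close>
    have "(\<lambda>n. 1 + 1 / real n - real (Suc (k n)) / real n) \<longlonglongrightarrow> 1 + 0 - x"
      by (intro tendsto_diff tendsto_add tendsto_const lim_1_over_n lim1)
    moreover have "\<forall>\<^sub>F n in sequentially.
        1 + 1 / real n - real (Suc (k n)) / real n = real (n - k n) / real n"
      using eventually_gt_at_top[of 0]
    proof eventually_elim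
      case (elim n)
      then show ?case using k_less[of n] by (simp add: of_nat_diff diff_divide_distrib add_divide_distrib)
    qed
    ultimately show ?thesis
      using Lim_transform_eventually by fastforce
  qed
  define D where "D z m = ln (real m) - (\<Sum>j<m. inverse (z + real j))" for z :: real and m
  have D: "D z \<longlonglongrightarrow> Digamma z" if "z \<noteq> 0" for z
    using Digamma_LIMSEQ[OF that] by (simp add: D_def[abs_def])
  \<comment> \<open>The logarithms in the two \<open>D\<close> terms each diverge, but their
    difference is the logarithm of a ratio of lengths. Dividing both lengths by \<open>n\<close>
    makes its limit visible, and subtracting it leaves exactly \<open>logderiv_p\<close>.\<close>
  have "(\<lambda>n. D (1 - l) (n - k n) - D l (Suc (k n))
        - ln ((real (n - k n) / real n) / (real (Suc (k n)) / real n)))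
      \<longlonglongrightarrow> Digamma (1 - l) - Digamma l - ln ((1 - x) / x)"
    using x l by (intro tendsto_intros lim1 lim2 filterlim_compose[OF D]
        at_top_if_ratio_tendsto_pos[OF lim1] at_top_if_ratio_tendsto_pos[OF lim2]) auto
  moreover have "\<forall>\<^sub>F n in sequentially.
      D (1 - l) (n - k n) - D l (Suc (k n))
        - ln ((real (n - k n) / real n) / (real (Suc (k n)) / real n))
      = logderiv_p n (real (k n) + l)"
    using eventually_gt_at_top[of 0]
  proof eventually_elim
    case (elim n)
    then have "ln ((real (n - k n) / real n) / (real (Suc (k n)) / real n))
        = ln (real (n - k n)) - ln (real (Suc (k n)))"
      using k_less[of n] by (simp add: ln_div del: of_nat_Suc)
    then show ?case
      using k_less[of n] elim by (simp add: logderiv_p_split D_def del: sum.lessThan_Suc)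
  qed
  ultimately show ?thesis
    unfolding Digamma_reflection_real[OF l] k_def[symmetric] by (rule Lim_transform_eventually)
qed

lemma lam_tendsto:
  fixes x :: real
  assumes x: "0 < x" "x < 1"
  shows "(\<lambda>n. lam n (nat \<lfloor>x * real n\<rfloor>)) \<longlonglongrightarrow> 1 / pi * arccot (1 / pi * ln ((1 - x) / x))"
    (is "_ \<longlonglongrightarrow> ?L")
proof (rule order_tendstoI)
  define y where "y = 1 / pi * ln ((1 - x) / x)"
  \<comment> \<open>\<open>lam n k\<close> is known to be a root offset only for
    \<open>k < n\<close>.\<close>
  have k_less: "\<forall>\<^sub>F n in sequentially. nat \<lfloor>x * real n\<rfloor> < n"
    using eventually_gt_at_top[of 0]
  proof eventually_elim
    case (elim n)
    then have "x * real n < real n" "0 \<le> x * real n" using x by auto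
    then show ?case by linarith
  qed
  have L: "0 < ?L" "?L < 1"
    using arccot_bounds[of y] by (simp_all add: y_def)
  show "\<forall>\<^sub>F n in sequentially. a < lam n (nat \<lfloor>x * real n\<rfloor>)" if "a < ?L" for a
  proof -
    \<comment> \<open>The bound \<open>a\<close> may be negative; a test point above
      \<open>max a 0\<close> and below \<open>?L\<close> lies in (0, 1), where the limit of
      \<open>logderiv_p\<close> is available.\<close>
    have "max a 0 < ?L"
      using that L(1) by (simp only: max_less_iff_conj)
    then obtain l where l: "max a 0 < l" "l < ?L"
      using dense by blast
    have l01: "0 < l" "l < 1"
      using l(1) less_trans[OF l(2) L(2)] by simp_all
    have "pi * l < arccot y"
      using l(2) by (simp add: y_def field_simps)
    then have "y < cot (pi * l)"
      using l01 arccot_less_iff(1)[of "pi * l" y] by simp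
    then have "0 < pi * cot (pi * l) - ln ((1 - x) / x)"
      by (simp add: y_def field_simps)
    then have "\<forall>\<^sub>F n in sequentially. 0 < logderiv_p n (real (nat \<lfloor>x * real n\<rfloor>) + l)"
      by (rule order_tendstoD(1)[OF logderiv_p_tendsto[OF x l01]])
    with k_less show ?thesis
    proof eventually_elim
      case (elim n)
      then show ?case using less_lam_if_logderiv_p_pos[OF elim(1) l01 elim(2)] l(1) by simp
    qed
  qed
  show "\<forall>\<^sub>F n in sequentially. lam n (nat \<lfloor>x * real n\<rfloor>) < a" if "?L < a" for a
  proof -
    \<comment> \<open>Symmetrically, \<open>a\<close> may exceed 1, so the test point is taken below
      \<open>min a 1\<close>.\<close>
    have "?L < min a 1"
      using that L(2) by (simp only: min_less_iff_conj)
    then obtain l where l: "?L < l" "l < min a 1"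
      using dense by blast
    have l01: "0 < l" "l < 1"
      using l(2) less_trans[OF L(1) l(1)] by simp_all
    have "arccot y < pi * l"
      using l(1) by (simp add: y_def field_simps)
    then have "cot (pi * l) < y"
      using l01 arccot_less_iff(2)[of "pi * l" y] by simp
    then have "pi * cot (pi * l) - ln ((1 - x) / x) < 0"
      by (simp add: y_def field_simps)
    then have "\<forall>\<^sub>F n in sequentially. logderiv_p n (real (nat \<lfloor>x * real n\<rfloor>) + l) < 0"
      by (rule order_tendstoD(2)[OF logderiv_p_tendsto[OF x l01]])
    with k_less show ?thesis
    proof eventually_elim
      case (elim n)
      then show ?case using lam_less_if_logderiv_p_neg[OF elim(1) l01 elim(2)] l(2) by simp
    qed
  qed
qed

text \<open>The first conjunct certifies that the description defining \<open>lam\<close> yields the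
  numbers in the factorization of the derivative; the second is the limit.\<close>

theorem theorem4:
  "(\<forall>n\<ge>1.
      (\<forall>k<n. \<exists>!t. real k < t \<and> t < real k + 1 \<and> poly (pderiv (p n)) t = 0) \<and>
      (\<forall>k<n. 0 < lam n k \<and> lam n k < 1) \<and>
      pderiv (p n) = smult (real n + 1) (\<Prod>k=0..<n. [:- (real k + lam n k), 1:])) \<and>
   (\<forall>x::real. 0 < x \<and> x < 1 \<longrightarrow>
      (\<lambda>n. lam n (nat \<lfloor>x * real n\<rfloor>)) \<longlonglongrightarrow> 1 / pi * arccot (1 / pi * ln ((1 - x) / x)))"
  by (intro conjI allI impI ex1_root_pderiv_p lam_root pderiv_p_factorization lam_tendsto) auto

end
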